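(* Let $\beta=(\beta_n)_{n\ge0}$ be an essentially decreasing sequence of positive numbers with $\liminf_n\beta_n^{1/n}\ge1$, satisfying the $\Delta_2$-condition. Then for every symbol $\phi$, the composition operator $C_\phi$ is bounded on $H^2(\beta)$.
   Context: $H^2(\beta)$ is the Hilbert space of analytic functions $f(z)=\sum_{n\ge0}a_nz^n$ on the unit disk $\mathbb D$ with $\|f\|^2=\sum_{n\ge0}|a_n|^2\beta_n<\infty$. A symbol is a non-constant analytic map $\phi:\mathbb D\to\mathbb D$ and $C_\phi f=f\circ\phi$. $\beta$ is essentially decreasing if there is $C\ge1$ with $\beta_m\le C\beta_n$ for all $m\ge n\ge0$. $\beta$ satisfies the $\Delta_2$-condition if there is $\delta\in(0,1)$ with $\beta_{2n}\ge\delta\beta_n$ for all $n\ge0$. *)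

theory Defs
  imports "HOL-Analysis.Analysis" "HOL-Library.Liminf_Limsup"
begin

definition essentially_decreasing :: "(nat \<Rightarrow> real) \<Rightarrow> bool" where
  "essentially_decreasing \<beta> \<longleftrightarrow> (\<exists>C\<ge>1. \<forall>m n. n \<le> m \<longrightarrow> \<beta> m \<le> C * \<beta> n)"

definition Delta2_condition :: "(nat \<Rightarrow> real) \<Rightarrow> bool" where
  "Delta2_condition \<beta> \<longleftrightarrow> (\<exists>\<delta>. 0 < \<delta> \<and> \<delta> < 1 \<and> (\<forall>n. \<beta> (2*n) \<ge> \<delta> * \<beta> n))"

definition in_H2 :: "(nat \<Rightarrow> real) \<Rightarrow> (nat \<Rightarrow> complex) \<Rightarrow> bool" where
  "in_H2 \<beta> a \<longleftrightarrow> summable (\<lambda>n. (cmod (a n))\<^sup>2 * \<beta> n)"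

definition H2_norm :: "(nat \<Rightarrow> real) \<Rightarrow> (nat \<Rightarrow> complex) \<Rightarrow> real" where
  "H2_norm \<beta> a = sqrt (\<Sum>n. (cmod (a n))\<^sup>2 * \<beta> n)"

definition H2_fun :: "(nat \<Rightarrow> complex) \<Rightarrow> complex \<Rightarrow> complex" where
  "H2_fun a z = (\<Sum>n. a n * z ^ n)"

definition symbol :: "(complex \<Rightarrow> complex) \<Rightarrow> bool" where
  "symbol \<phi> \<longleftrightarrow> \<phi> holomorphic_on ball 0 1 \<and> \<phi> ` ball 0 1 \<subseteq> ball 0 1
     \<and> \<not> (\<exists>c. \<forall>z\<in>ball 0 1. \<phi> z = c)"

definition comp_op_bounded :: "(nat \<Rightarrow> real) \<Rightarrow> (complex \<Rightarrow> complex) \<Rightarrow> bool" where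
  "comp_op_bounded \<beta> \<phi> \<longleftrightarrow> (\<exists>M. \<forall>a. in_H2 \<beta> a \<longrightarrow>
     (\<exists>b. in_H2 \<beta> b \<and> (\<forall>z\<in>ball 0 1. H2_fun a (\<phi> z) = H2_fun b z)
          \<and> H2_norm \<beta> b \<le> M * H2_norm \<beta> a))"

end

theory Submission
  imports Defs "HOL-Complex_Analysis.Complex_Analysis"
begin

text \<open>
  After replacing \<open>\<beta>\<close> by the equivalent decreasing weight \<open>min {\<beta> m | m \<le> n}\<close>, Abel summation
  reduces the claim to the unweighted partial sums of \<open>|b j|\<^sup>2\<close>, \<open>b\<close> the coefficients of
  \<open>f \<circ> \<phi>\<close>. For these, split \<open>f\<close> at the index \<open>K N\<close>. Littlewood's subordination bounds the
  first \<open>N\<close> coefficients of the image of the low part by the sum of \<open>|a k|\<^sup>2\<close> over \<open>k < K N\<close>. On the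
  circle of radius 1/2 the function \<open>\<phi>\<close> stays inside a smaller disk, so for \<open>K\<close> large Cauchy's
  inequality makes the contribution of the high part exponentially small in \<open>N\<close>. The
  \<open>\<Delta>\<^sub>2\<close>-condition absorbs the dilation by \<open>K\<close>.
\<close>

section \<open>Quadratic means over circles\<close>

text \<open>\<open>circlepath\<close> runs over the unit interval, so the integral is already the
  normalised mean and no factor 1/(2 pi) appears.\<close>

definition mean_sq :: "real \<Rightarrow> (complex \<Rightarrow> complex) \<Rightarrow> real" where
  "mean_sq r F = integral {0..1} (\<lambda>t. (cmod (F (circlepath 0 r t)))\<^sup>2)"

lemma norm_circlepath_0: "0 \<le> r \<Longrightarrow> cmod (circlepath 0 r t) = r"
  by (simp add: circlepath norm_mult)

lemma continuous_on_compose_circlepath: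
  assumes "F holomorphic_on ball 0 1" "0 < r" "r < 1"
  shows "continuous_on S (\<lambda>t. F (circlepath 0 r t))"
proof (rule continuous_on_compose2[where g = F and f = "circlepath 0 r"])
  show "continuous_on (ball 0 1) F"
    using assms holomorphic_on_imp_continuous_on by blast
  show "continuous_on S (circlepath 0 r)"
    unfolding circlepath by (intro continuous_intros)
  show "circlepath 0 r ` S \<subseteq> ball 0 1"
    using assms by (auto simp: norm_circlepath_0)
qed

text \<open>Cauchy's formula at the centre: the quotient by z cancels the derivative of
  \<open>circlepath\<close> up to the factor 2 pi i.\<close>

lemma mean_value_circlepath:
  assumes "F holomorphic_on ball 0 1" "0 < r" "r < 1"
  shows "((\<lambda>t. F (circlepath 0 r t)) has_integral F 0) {0..1}"
proof -
  have "((\<lambda>u. F u / (u - 0)) has_contour_integral (2 * of_real pi * \<i> * F 0)) (circlepath 0 r)"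
    using assms by (intro Cauchy_integral_circlepath_simple) (auto elim!: holomorphic_on_subset)
  then have "((\<lambda>t. F (circlepath 0 r t) / circlepath 0 r t
      * (2 * of_real pi * \<i> * r * exp (2 * of_real pi * \<i> * t)))
      has_integral (2 * of_real pi * \<i> * F 0)) {0..1}"
    by (simp add: has_contour_integral vector_derivative_circlepath)
  then have "((\<lambda>t. F (circlepath 0 r t) / circlepath 0 r t
      * (2 * of_real pi * \<i> * r * exp (2 * of_real pi * \<i> * t)) * (1 / (2 * of_real pi * \<i>)))
      has_integral (2 * of_real pi * \<i> * F 0 * (1 / (2 * of_real pi * \<i>)))) {0..1}"
    by (rule has_integral_mult_left)
  moreover have "F (circlepath 0 r t) / circlepath 0 r t
      * (2 * of_real pi * \<i> * r * exp (2 * of_real pi * \<i> * t)) * (1 / (2 * of_real pi * \<i>))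
      = F (circlepath 0 r t)" for t
    using assms by (simp add: circlepath field_simps)
  ultimately show ?thesis
    by simp
qed

lemma integrable_cmod_sq_circlepath:
  assumes "F holomorphic_on ball 0 1" "0 < r" "r < 1"
  shows "(\<lambda>t. (cmod (F (circlepath 0 r t)))\<^sup>2) integrable_on {0..1}"
  using continuous_on_compose_circlepath[OF assms]
  by (intro integrable_continuous_real continuous_intros)

text \<open>\<open>F\<close> may be arbitrary because \<open>integral\<close> is 0 for a
  non-integrable function.\<close>

lemma mean_sq_nonneg: "mean_sq r F \<ge> 0"
  unfolding mean_sq_def by (cases "(\<lambda>t. (cmod (F (circlepath 0 r t)))\<^sup>2) integrable_on {0..1}")
    (auto intro: integral_nonneg simp: not_integrable_integral)

lemma mean_sq_mono:
  assumes "F holomorphic_on ball 0 1" "G holomorphic_on ball 0 1" "0 < r" "r < 1"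
    and "\<And>z. cmod z = r \<Longrightarrow> cmod (F z) \<le> cmod (G z)"
  shows "mean_sq r F \<le> mean_sq r G"
  unfolding mean_sq_def
  using assms by (intro integral_le integrable_cmod_sq_circlepath power_mono)
    (auto simp: norm_circlepath_0)

text \<open>After expanding the square, the cross term averages to its value at 0 by the mean value
  property. If \<open>F 0 = 0\<close>, this is Pythagoras' theorem.\<close>

lemma mean_sq_add_const:
  assumes "F holomorphic_on ball 0 1" "0 < r" "r < 1"
  shows "mean_sq r (\<lambda>z. c + F z) = (cmod c)\<^sup>2 + 2 * Re (cnj c * F 0) + mean_sq r F"
proof -
  let ?z = "circlepath 0 r"
  have expand: "(cmod (c + F (?z t)))\<^sup>2
      = (cmod c)\<^sup>2 + 2 * Re (cnj c * F (?z t)) + (cmod (F (?z t)))\<^sup>2" for t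
    unfolding cmod_power2 by (simp add: power2_eq_square algebra_simps)
  have "((\<lambda>t. Re (cnj c * F (?z t))) has_integral Re (cnj c * F 0)) {0..1}"
    using has_integral_linear[OF has_integral_mult_right[OF mean_value_circlepath[OF assms], of "cnj c"]
      bounded_linear_Re] unfolding o_def .
  from has_integral_add[OF has_integral_add[OF has_integral_const_real[of "(cmod c)\<^sup>2" 0 1]
        has_integral_mult_right[OF this, of 2]]
      integrable_integral[OF integrable_cmod_sq_circlepath[OF assms]]]
  have "((\<lambda>t. (cmod c)\<^sup>2 + 2 * Re (cnj c * F (?z t)) + (cmod (F (?z t)))\<^sup>2) has_integral
      ((cmod c)\<^sup>2 + 2 * Re (cnj c * F 0) + mean_sq r F)) {0..1}"
    by (simp add: mean_sq_def)
  then show ?thesis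
    unfolding mean_sq_def expand by (rule integral_unique)
qed

lemma mean_sq_ident_mult:
  assumes "0 \<le> r"
  shows "mean_sq r (\<lambda>z. z * F z) = r\<^sup>2 * mean_sq r F"
  using assms by (simp add: mean_sq_def norm_mult norm_circlepath_0 power_mult_distrib)

section \<open>Power series on the unit disk\<close>

lemma H2_fun_holomorphic:
  assumes "\<And>z. z \<in> ball 0 1 \<Longrightarrow> summable (\<lambda>n. b n * z ^ n)"
  shows "H2_fun b holomorphic_on ball 0 1"
  using assms by (intro power_series_holomorphic[of 0 1 b]) (auto simp: H2_fun_def summable_sums)

lemma summable_shifted_power_series:
  fixes b :: "nat \<Rightarrow> complex"
  assumes "summable (\<lambda>n. b n * z ^ n)"
  shows "summable (\<lambda>n. b (Suc n) * z ^ n)"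
proof (cases "z = 0")
  case True
  then show ?thesis by simp
next
  case False
  have "summable (\<lambda>n. b (Suc n) * z ^ Suc n)"
    using assms by (subst summable_Suc_iff)
  then have "summable (\<lambda>n. inverse z * (b (Suc n) * z ^ Suc n))"
    by (rule summable_mult)
  then show ?thesis
    using False by (simp add: field_simps)
qed

lemma H2_fun_split_head:
  assumes "summable (\<lambda>n. b n * z ^ n)"
  shows "H2_fun b z = b 0 + z * H2_fun (\<lambda>n. b (Suc n)) z"
proof -
  have "(\<Sum>n. b (Suc n) * z ^ Suc n) = z * (\<Sum>n. b (Suc n) * z ^ n)"
    using suminf_mult[OF summable_shifted_power_series[OF assms], of z] by (simp add: mult_ac)
  then show ?thesis
    using suminf_split_head[OF assms] by (simp add: H2_fun_def algebra_simps)
qed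

text \<open>A one-sided Parseval identity, by peeling off coefficients: the constant term is
  orthogonal to \<open>z * H2_fun ?b z\<close>, which vanishes at 0, and the factor z scales the
  mean by r^2. No sum and integral have to be interchanged.\<close>

lemma bessel_mean_sq:
  assumes "\<And>z. z \<in> ball 0 1 \<Longrightarrow> summable (\<lambda>n. b n * z ^ n)" "0 < r" "r < 1"
  shows "(\<Sum>j<N. (cmod (b j))\<^sup>2 * r ^ (2 * j)) \<le> mean_sq r (H2_fun b)"
  using assms(1)
proof (induction N arbitrary: b)
  case 0
  then show ?case by (simp add: mean_sq_nonneg)
next
  case (Suc N)
  let ?b = "\<lambda>n. b (Suc n)"
  have sm: "summable (\<lambda>n. ?b n * z ^ n)" if "z \<in> ball 0 1" for z
    using Suc.prems[OF that] by (rule summable_shifted_power_series)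
  have hol: "(\<lambda>z. z * H2_fun ?b z) holomorphic_on ball 0 1"
    using H2_fun_holomorphic[of ?b] sm by (intro holomorphic_intros) auto
  have "mean_sq r (H2_fun b) = mean_sq r (\<lambda>z. b 0 + z * H2_fun ?b z)"
    unfolding mean_sq_def
    using assms(2,3) Suc.prems by (intro integral_cong) (simp add: H2_fun_split_head norm_circlepath_0)
  also have "\<dots> = (cmod (b 0))\<^sup>2 + r\<^sup>2 * mean_sq r (H2_fun ?b)"
    using mean_sq_add_const[OF hol assms(2,3)] assms(2) by (simp add: mean_sq_ident_mult)
  finally have *: "mean_sq r (H2_fun b) = (cmod (b 0))\<^sup>2 + r\<^sup>2 * mean_sq r (H2_fun ?b)" .
  have "(\<Sum>j<Suc N. (cmod (b j))\<^sup>2 * r ^ (2 * j))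
      = (cmod (b 0))\<^sup>2 + r\<^sup>2 * (\<Sum>j<N. (cmod (?b j))\<^sup>2 * r ^ (2 * j))"
    by (simp only: sum.lessThan_Suc_shift) (simp add: sum_distrib_left power_add power2_eq_square mult_ac)
  also have "\<dots> \<le> (cmod (b 0))\<^sup>2 + r\<^sup>2 * mean_sq r (H2_fun ?b)"
    using Suc.IH[of ?b] sm by (intro add_left_mono mult_left_mono) auto
  finally show ?case
    using * by simp
qed

definition taylor_coeff :: "(complex \<Rightarrow> complex) \<Rightarrow> nat \<Rightarrow> complex" where
  "taylor_coeff F n = (deriv ^^ n) F 0 / fact n"

lemma taylor_coeff_sums:
  assumes "F holomorphic_on ball 0 1" "z \<in> ball 0 1"
  shows "(\<lambda>n. taylor_coeff F n * z ^ n) sums F z"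
  using holomorphic_power_series[OF assms] by (simp add: taylor_coeff_def)

lemma H2_fun_taylor_coeff:
  assumes "F holomorphic_on ball 0 1" "z \<in> ball 0 1"
  shows "H2_fun (taylor_coeff F) z = F z"
  using taylor_coeff_sums[OF assms] by (simp add: H2_fun_def sums_iff)

lemma taylor_coeff_add:
  assumes "F holomorphic_on ball 0 1" "G holomorphic_on ball 0 1"
  shows "taylor_coeff (\<lambda>z. F z + G z) n = taylor_coeff F n + taylor_coeff G n"
  using higher_deriv_add[OF assms, of 0 n] by (simp add: taylor_coeff_def add_divide_distrib)

lemma taylor_coeff_le:
  assumes "F holomorphic_on ball 0 1" "0 < r" "r < 1" "\<And>z. cmod z = r \<Longrightarrow> cmod (F z) \<le> B"
  shows "cmod (taylor_coeff F n) \<le> B / r ^ n"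
proof -
  have "cmod ((deriv ^^ n) F 0) \<le> fact n * B / r ^ n"
    using assms
    by (intro Cauchy_inequality holomorphic_on_imp_continuous_on)
      (auto elim!: holomorphic_on_subset)
  then show ?thesis
    by (simp add: taylor_coeff_def norm_divide field_simps)
qed

text \<open>Bessel's inequality holds for each r < 1; its left side is a polynomial in r, so r may
  tend to 1.\<close>

lemma taylor_coeff_sq_sum_le:
  assumes hol: "F holomorphic_on ball 0 1"
    and bd: "\<And>r. 0 < r \<Longrightarrow> r < 1 \<Longrightarrow> mean_sq r F \<le> B"
  shows "(\<Sum>j<N. (cmod (taylor_coeff F j))\<^sup>2) \<le> B"
proof (rule tendsto_upperbound)
  show "((\<lambda>r. \<Sum>j<N. (cmod (taylor_coeff F j))\<^sup>2 * r ^ (2 * j)) \<longlongrightarrow>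
      (\<Sum>j<N. (cmod (taylor_coeff F j))\<^sup>2)) (at_left (1::real))"
    by (auto intro!: tendsto_eq_intros)
  have "(\<Sum>j<N. (cmod (taylor_coeff F j))\<^sup>2 * r ^ (2 * j)) \<le> B" if r: "0 < r" "r < 1" for r
  proof -
    have "(\<Sum>j<N. (cmod (taylor_coeff F j))\<^sup>2 * r ^ (2 * j)) \<le> mean_sq r (H2_fun (taylor_coeff F))"
      using r taylor_coeff_sums[OF hol] by (intro bessel_mean_sq) (auto simp: sums_iff)
    also have "\<dots> = mean_sq r F"
      unfolding mean_sq_def
      using r H2_fun_taylor_coeff[OF hol] by (intro integral_cong) (simp add: norm_circlepath_0)
    finally show ?thesis
      using bd[OF r] by simp
  qed
  moreover have "\<forall>\<^sub>F r in at_left (1::real). r \<in> {0<..<1}"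
    by (rule eventually_at_leftI[of 0]) auto
  ultimately show "\<forall>\<^sub>F r in at_left 1. (\<Sum>j<N. (cmod (taylor_coeff F j))\<^sup>2 * r ^ (2 * j)) \<le> B"
    by (auto elim: eventually_mono)
qed auto

section \<open>Littlewood's subordination principle\<close>

text \<open>
  Following Littlewood, peel off \<open>a 0\<close> and use that multiplication by \<open>\<phi>\<close> is a contraction. As
  \<open>\<phi> 0 \<noteq> 0\<close> is allowed, a cross term appears; the summand with \<open>\<phi> 0\<close> is the potential that
  absorbs it in the induction.
\<close>

lemma littlewood_mean_sq:
  assumes hol: "\<phi> holomorphic_on ball 0 1" and sub: "\<phi> ` ball 0 1 \<subseteq> ball 0 1"
    and r: "0 < r" "r < 1"
  defines "d \<equiv> 1 - cmod (\<phi> 0)"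
  shows "mean_sq r (\<lambda>z. \<Sum>k<n. a k * \<phi> z ^ k) + (cmod (\<Sum>k<n. a k * \<phi> 0 ^ k))\<^sup>2 / d
    \<le> (2 + 1 / d\<^sup>2) * (\<Sum>k<n. (cmod (a k))\<^sup>2)"
proof (induction n arbitrary: a)
  case 0
  then show ?case by (simp add: mean_sq_def)
next
  case (Suc n)
  define G where "G z = (\<Sum>k<n. a (Suc k) * \<phi> z ^ k)" for z
  define x y s where "x = cmod (a 0)" and "y = cmod (G 0)" and "s = cmod (\<phi> 0)"
  have lt1: "cmod (\<phi> z) < 1" if "cmod z < 1" for z
    using sub that by (auto simp: image_subset_iff)
  have d: "0 < d" "d \<le> 1" "s = 1 - d" and nn: "x \<ge> 0" "y \<ge> 0" "s \<ge> 0"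
    using lt1[of 0] by (auto simp: d_def x_def y_def s_def)
  have holG: "G holomorphic_on ball 0 1"
    unfolding G_def using hol by (intro holomorphic_intros)
  have hol': "(\<lambda>z. \<phi> z * G z) holomorphic_on ball 0 1"
    using hol holG by (intro holomorphic_intros)
  have split: "(\<Sum>k<Suc n. a k * \<phi> z ^ k) = a 0 + \<phi> z * G z" for z
    by (simp only: sum.lessThan_Suc_shift) (simp add: G_def sum_distrib_left mult_ac)
  have re: "2 * Re (cnj (a 0) * (\<phi> 0 * G 0)) \<le> 2 * (x * y)"
  proof -
    have "Re (cnj (a 0) * (\<phi> 0 * G 0)) \<le> cmod (cnj (a 0) * (\<phi> 0 * G 0))"
      by (rule complex_Re_le_cmod)
    also have "\<dots> = s * (x * y)"
      by (simp add: norm_mult x_def y_def s_def)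
    also have "\<dots> \<le> 1 * (x * y)"
      using d nn by (intro mult_right_mono) auto
    finally show ?thesis by simp
  qed
  have "mean_sq r (\<lambda>z. \<phi> z * G z) \<le> mean_sq r G"
  proof (rule mean_sq_mono[OF hol' holG r])
    fix z :: complex
    assume "cmod z = r"
    then have "cmod (\<phi> z) \<le> 1"
      using lt1[of z] r by simp
    then show "cmod (\<phi> z * G z) \<le> cmod (G z)"
      by (simp add: norm_mult mult_left_le_one_le)
  qed
  then have A: "mean_sq r (\<lambda>z. a 0 + \<phi> z * G z) \<le> x\<^sup>2 + 2 * (x * y) + mean_sq r G"
    using mean_sq_add_const[OF hol' r, of "a 0"] re by (simp add: x_def)
  \<comment> \<open>convexity of the square, with weights \<open>d\<close> and \<open>s = 1 - d\<close>\<close>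
  have B: "(cmod (a 0 + \<phi> 0 * G 0))\<^sup>2 \<le> x\<^sup>2 / d + s * y\<^sup>2"
  proof -
    have "cmod (a 0 + \<phi> 0 * G 0) \<le> x + s * y"
      using norm_triangle_ineq[of "a 0" "\<phi> 0 * G 0"] by (simp add: norm_mult x_def y_def s_def)
    then have "(cmod (a 0 + \<phi> 0 * G 0))\<^sup>2 \<le> (x + s * y)\<^sup>2"
      by (intro power_mono) auto
    also have "\<dots> = x\<^sup>2 / d + s * y\<^sup>2 - s * d * (x / d - y)\<^sup>2"
      using d(1) unfolding d(3) by (simp add: field_simps power2_eq_square)
    also have "\<dots> \<le> x\<^sup>2 / d + s * y\<^sup>2"
      using d nn by simp
    finally show ?thesis .
  qed
  have "(cmod (a 0 + \<phi> 0 * G 0))\<^sup>2 / d \<le> (x\<^sup>2 / d + s * y\<^sup>2) / d"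
    using B d by (intro divide_right_mono) auto
  \<comment> \<open>Since s = 1 - d, the potential of \<open>G\<close> loses exactly y^2. This pays
    for the y^2 that arises when the cross term 2xy in \<open>A\<close> is bounded by x^2 +
    y^2.\<close>
  also have "\<dots> = x\<^sup>2 / d\<^sup>2 + y\<^sup>2 / d - y\<^sup>2"
    using d(1) unfolding d(3) by (simp add: field_simps power2_eq_square)
  finally have C: "(cmod (a 0 + \<phi> 0 * G 0))\<^sup>2 / d \<le> x\<^sup>2 / d\<^sup>2 + y\<^sup>2 / d - y\<^sup>2" .
  have xy: "2 * (x * y) \<le> x\<^sup>2 + y\<^sup>2"
    using sum_squares_bound[of x y] by simp
  have IH: "mean_sq r G + y\<^sup>2 / d \<le> (2 + 1 / d\<^sup>2) * (\<Sum>k<n. (cmod (a (Suc k)))\<^sup>2)"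
    using Suc.IH[of "\<lambda>k. a (Suc k)"] by (simp add: G_def[abs_def] y_def)
  have "mean_sq r (\<lambda>z. a 0 + \<phi> z * G z) + (cmod (a 0 + \<phi> 0 * G 0))\<^sup>2 / d
      \<le> (2 + 1 / d\<^sup>2) * x\<^sup>2 + (2 + 1 / d\<^sup>2) * (\<Sum>k<n. (cmod (a (Suc k)))\<^sup>2)"
    using A C xy IH by (simp add: algebra_simps)
  also have "\<dots> = (2 + 1 / d\<^sup>2) * (\<Sum>k<Suc n. (cmod (a k))\<^sup>2)"
    by (simp only: sum.lessThan_Suc_shift) (simp add: x_def distrib_left)
  finally show ?case
    unfolding split .
qed

text \<open>The nonnegative potential is dropped. What matters is that \<open>A\<close> depends on
  \<open>\<phi>\<close> alone, so that \<open>n\<close> can later grow with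
  \<open>N\<close>.\<close>

lemma littlewood_taylor_coeff:
  assumes "\<phi> holomorphic_on ball 0 1" "\<phi> ` ball 0 1 \<subseteq> ball 0 1"
  obtains A where "A > 0"
    "\<And>a n N. (\<Sum>j<N. (cmod (taylor_coeff (\<lambda>z. \<Sum>k<n. a k * \<phi> z ^ k) j))\<^sup>2)
      \<le> A * (\<Sum>k<n. (cmod (a k))\<^sup>2)"
proof
  define d where "d = 1 - cmod (\<phi> 0)"
  have "cmod (\<phi> 0) < 1"
    using assms(2) by (auto simp: image_subset_iff)
  then have d: "d > 0" by (simp add: d_def)
  then show "2 + 1 / d\<^sup>2 > 0"
    by (simp add: add_pos_nonneg)
  fix a n N
  show "(\<Sum>j<N. (cmod (taylor_coeff (\<lambda>z. \<Sum>k<n. a k * \<phi> z ^ k) j))\<^sup>2)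
      \<le> (2 + 1 / d\<^sup>2) * (\<Sum>k<n. (cmod (a k))\<^sup>2)"
  proof (rule taylor_coeff_sq_sum_le)
    show "(\<lambda>z. \<Sum>k<n. a k * \<phi> z ^ k) holomorphic_on ball 0 1"
      using assms(1) by (intro holomorphic_intros)
    fix r :: real
    assume "0 < r" "r < 1"
    from littlewood_mean_sq[OF assms this, where n = n and a = a, folded d_def]
    have "mean_sq r (\<lambda>z. \<Sum>k<n. a k * \<phi> z ^ k) + (cmod (\<Sum>k<n. a k * \<phi> 0 ^ k))\<^sup>2 / d
      \<le> (2 + 1 / d\<^sup>2) * (\<Sum>k<n. (cmod (a k))\<^sup>2)" .
    moreover have "(cmod (\<Sum>k<n. a k * \<phi> 0 ^ k))\<^sup>2 / d \<ge> 0"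
      using d by simp
    ultimately show "mean_sq r (\<lambda>z. \<Sum>k<n. a k * \<phi> z ^ k)
        \<le> (2 + 1 / d\<^sup>2) * (\<Sum>k<n. (cmod (a k))\<^sup>2)"
      by linarith
  qed
qed

section \<open>Weighted estimates\<close>

text \<open>Summation by parts turns the weighted sum into a combination of partial sums of
  \<open>d\<close> with coefficients \<open>\<gamma> j - \<gamma> (Suc j)\<close> and a last
  \<open>\<gamma>\<close>, all nonnegative. It transfers unweighted estimates to decreasing
  weights.\<close>

lemma abel_summation_nonneg:
  fixes \<gamma> d :: "nat \<Rightarrow> real"
  assumes anti: "\<And>m n. m \<le> n \<Longrightarrow> \<gamma> n \<le> \<gamma> m" and nn: "\<And>n. 0 \<le> \<gamma> n"
    and d: "\<And>N. 0 \<le> (\<Sum>j<N. d j)"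
  shows "0 \<le> (\<Sum>j<N. \<gamma> j * d j)"
proof (cases N)
  case (Suc M)
  \<comment> \<open>Nonnegativity alone is not inductive, since \<open>d\<close> may be negative at
    single indices; the induction carries this stronger lower bound.\<close>
  have "\<gamma> M * (\<Sum>j<Suc M. d j) \<le> (\<Sum>j<Suc M. \<gamma> j * d j)"
  proof (induction M)
    case (Suc M)
    have "\<gamma> (Suc M) * (\<Sum>j<Suc M. d j) \<le> \<gamma> M * (\<Sum>j<Suc M. d j)"
      by (rule mult_right_mono[OF anti d]) simp
    with Suc have "\<gamma> (Suc M) * (\<Sum>j<Suc M. d j) \<le> (\<Sum>j<Suc M. \<gamma> j * d j)"
      by linarith
    then show ?case
      by (simp add: distrib_left)
  qed simp
  moreover have "0 \<le> \<gamma> M * (\<Sum>j<Suc M. d j)"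
    using nn[of M] d[of "Suc M"] by (rule mult_nonneg_nonneg)
  ultimately show ?thesis
    unfolding Suc by (rule order_trans[rotated])
qed simp

lemma H2_norm_nonneg:
  assumes "\<And>n. \<gamma> n > 0" "in_H2 \<gamma> a"
  shows "0 \<le> H2_norm \<gamma> a"
  using assms unfolding H2_norm_def in_H2_def
  by (intro real_sqrt_ge_zero suminf_nonneg mult_nonneg_nonneg less_imp_le[OF assms(1)]) auto

lemma H2_partial_sum_le:
  assumes "\<And>n. \<gamma> n > 0" "in_H2 \<gamma> a" "finite S"
  shows "(\<Sum>n\<in>S. (cmod (a n))\<^sup>2 * \<gamma> n) \<le> (H2_norm \<gamma> a)\<^sup>2"
proof -
  have sm: "summable (\<lambda>n. (cmod (a n))\<^sup>2 * \<gamma> n)" and nn: "\<And>n. 0 \<le> (cmod (a n))\<^sup>2 * \<gamma> n"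
    using assms by (auto simp: in_H2_def less_imp_le)
  have "(H2_norm \<gamma> a)\<^sup>2 = (\<Sum>n. (cmod (a n))\<^sup>2 * \<gamma> n)"
    using suminf_nonneg[OF sm nn] by (simp add: H2_norm_def)
  with sum_le_suminf[OF sm assms(3)] nn show ?thesis
    by simp
qed

text \<open>A single term of the norm series controls \<open>a k\<close>. The lower bound on the
  weight is taken at s^2 because coefficients enter squared; \<open>D\<close> does not depend on
  \<open>a\<close>.\<close>

lemma H2_coeff_growth:
  fixes \<gamma> :: "nat \<Rightarrow> real"
  assumes pos: "\<And>n. \<gamma> n > 0"
    and low: "\<And>s. 0 < s \<Longrightarrow> s < 1 \<Longrightarrow> \<exists>c>0. \<forall>n. c * s ^ n \<le> \<gamma> n"
    and s: "0 < s" "s < 1"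
  obtains D where "D > 0" "\<And>a k. in_H2 \<gamma> a \<Longrightarrow> cmod (a k) * s ^ k \<le> D * H2_norm \<gamma> a"
proof -
  have "0 < s\<^sup>2" "s\<^sup>2 < 1"
    using s by (auto simp: power_less_one_iff)
  from low[OF this] obtain c where c: "c > 0" "\<And>n. c * (s\<^sup>2) ^ n \<le> \<gamma> n"
    by blast
  show thesis
  proof
    show "1 / sqrt c > 0"
      using c by simp
    fix a k
    assume a: "in_H2 \<gamma> a"
    have "(sqrt c * (cmod (a k) * s ^ k))\<^sup>2 = (cmod (a k))\<^sup>2 * (c * (s\<^sup>2) ^ k)"
      using c by (simp add: power_mult_distrib power_mult[symmetric] mult_ac)
    also have "\<dots> \<le> (cmod (a k))\<^sup>2 * \<gamma> k"
      using c by (intro mult_left_mono) auto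
    also have "\<dots> \<le> (H2_norm \<gamma> a)\<^sup>2"
      using H2_partial_sum_le[OF pos a, of "{k}"] by simp
    finally have "sqrt c * (cmod (a k) * s ^ k) \<le> H2_norm \<gamma> a"
      using H2_norm_nonneg[OF pos a] by (rule power2_le_imp_le)
    then show "cmod (a k) * s ^ k \<le> 1 / sqrt c * H2_norm \<gamma> a"
      using c by (simp add: field_simps)
  qed
qed

text \<open>Ensures that the series defining \<open>H2_fun a\<close> converges on the disk: for s
  between |z| and 1 it is dominated by a geometric series of ratio |z|/s.\<close>

lemma H2_summable_power_series:
  fixes \<gamma> :: "nat \<Rightarrow> real"
  assumes "\<And>n. \<gamma> n > 0"
    and "\<And>s. 0 < s \<Longrightarrow> s < 1 \<Longrightarrow> \<exists>c>0. \<forall>n. c * s ^ n \<le> \<gamma> n"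
    and a: "in_H2 \<gamma> a" and z: "z \<in> ball 0 1"
  shows "summable (\<lambda>n. a n * z ^ n)"
proof -
  obtain s where s: "cmod z < s" "s < 1"
    using z dense[of "cmod z" 1] by auto
  then have s0: "0 < s"
    using norm_ge_zero[of z] by linarith
  obtain D where D: "\<And>k. cmod (a k) * s ^ k \<le> D * H2_norm \<gamma> a"
    using H2_coeff_growth[OF assms(1,2) s0 s(2)] a by metis
  have "cmod (a k * z ^ k) \<le> D * H2_norm \<gamma> a * (cmod z / s) ^ k" for k
    using mult_right_mono[OF D[of k], of "(cmod z / s) ^ k"] s0
    by (simp add: norm_mult norm_power power_divide)
  moreover have "summable (\<lambda>k. D * H2_norm \<gamma> a * (cmod z / s) ^ k)"
    using s s0 by (intro summable_mult summable_geometric) auto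
  ultimately show ?thesis
    by (blast intro: summable_comparison_test'[where N = 0])
qed

text \<open>Of the two factors s^k that bound |w|^k, one absorbs the growth of the coefficients and
  the other gives geometric decay.\<close>

lemma H2_tail_le:
  assumes coeff: "\<And>k. cmod (a k) * s ^ k \<le> B" and s: "0 < s" "s < 1" and w: "cmod w \<le> s\<^sup>2"
    and sm: "summable (\<lambda>n. a n * w ^ n)"
  shows "cmod (H2_fun a w - (\<Sum>k<L. a k * w ^ k)) \<le> B * s ^ L / (1 - s)"
proof -
  have "H2_fun a w - (\<Sum>k<L. a k * w ^ k) = (\<Sum>k. a (k + L) * w ^ (k + L))"
    using suminf_split_initial_segment[OF sm, of L] by (simp add: H2_fun_def)
  also have "cmod \<dots> \<le> (\<Sum>k. B * s ^ L * s ^ k)"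
  proof (rule norm_suminf_le)
    fix k
    have "cmod (a (k + L) * w ^ (k + L)) \<le> cmod (a (k + L)) * (s\<^sup>2) ^ (k + L)"
      using w by (auto simp: norm_mult norm_power intro!: mult_left_mono power_mono)
    also have "\<dots> = (cmod (a (k + L)) * s ^ (k + L)) * s ^ (k + L)"
      by (simp add: power_mult[symmetric] mult_2 power_add)
    also have "\<dots> \<le> B * s ^ (k + L)"
      using coeff s by (intro mult_right_mono) auto
    finally show "cmod (a (k + L) * w ^ (k + L)) \<le> B * s ^ L * s ^ k"
      by (simp add: power_add mult_ac)
    show "summable (\<lambda>k. B * s ^ L * s ^ k)"
      using s by (intro summable_mult summable_geometric) auto
  qed
  also have "\<dots> = B * s ^ L / (1 - s)"
    using s by (subst suminf_mult) (auto simp: suminf_geometric)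
  finally show ?thesis .
qed

text \<open>Doubling q times gives the dilation by 2^q. The index \<open>Suc j\<close> makes the
  bound reach the end of the j-th block of length 2^q, hence by monotonicity the whole
  block.\<close>

lemma Delta2_block:
  fixes \<gamma> :: "nat \<Rightarrow> real"
  assumes pos: "\<And>n. \<gamma> n > 0" and anti: "\<And>m n. m \<le> n \<Longrightarrow> \<gamma> n \<le> \<gamma> m"
    and \<delta>: "0 < \<delta>" "\<And>n. \<delta> * \<gamma> n \<le> \<gamma> (2 * n)"
  obtains c where "c > 0" "\<And>j. c * \<gamma> j \<le> \<gamma> (2 ^ q * Suc j)"
proof
  \<comment> \<open>\<open>e\<close> pays for the shift from j to j + 1. For j > 0 the factor
    \<open>\<delta>\<close> suffices as j + 1 <= 2j; at j = 0 doubling gives nothing, whence the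
    quotient.\<close>
  define e where "e = min \<delta> (\<gamma> 1 / \<gamma> 0)"
  show "\<delta> ^ q * e > 0"
    using \<delta> pos by (simp add: e_def)
  fix j
  have 1: "e * \<gamma> j \<le> \<gamma> (Suc j)"
  proof (cases j)
    case 0
    have "e * \<gamma> 0 \<le> \<gamma> 1 / \<gamma> 0 * \<gamma> 0"
      using pos by (intro mult_right_mono) (auto simp: e_def less_imp_le)
    then show ?thesis
      using pos[of 0] 0 by simp
  next
    case (Suc i)
    have "e * \<gamma> j \<le> \<delta> * \<gamma> j"
      using pos by (intro mult_right_mono) (auto simp: e_def less_imp_le)
    also have "\<dots> \<le> \<gamma> (2 * j)"
      by (rule \<delta>)
    also have "\<dots> \<le> \<gamma> (Suc j)"
      using Suc by (intro anti) auto
    finally show ?thesis .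
  qed
  have 2: "\<delta> ^ q * \<gamma> n \<le> \<gamma> (2 ^ q * n)" for n
  proof (induction q)
    case (Suc q)
    have "\<delta> ^ Suc q * \<gamma> n \<le> \<delta> * \<gamma> (2 ^ q * n)"
      using Suc \<delta> by simp
    also have "\<dots> \<le> \<gamma> (2 ^ Suc q * n)"
      using \<delta>(2)[of "2 ^ q * n"] by (simp add: mult_ac)
    finally show ?case .
  qed simp
  have "\<delta> ^ q * e * \<gamma> j \<le> \<delta> ^ q * \<gamma> (Suc j)"
    using 1 \<delta> by (simp add: mult.assoc)
  also note 2
  finally show "\<delta> ^ q * e * \<gamma> j \<le> \<gamma> (2 ^ q * Suc j)" .
qed

section \<open>Boundedness for decreasing weights\<close>

lemma comp_op_bounded_antitone:
  fixes \<gamma> :: "nat \<Rightarrow> real"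
  assumes pos: "\<And>n. \<gamma> n > 0" and anti: "\<And>m n. m \<le> n \<Longrightarrow> \<gamma> n \<le> \<gamma> m"
    and \<delta>: "0 < \<delta>" "\<And>n. \<delta> * \<gamma> n \<le> \<gamma> (2 * n)"
    and low: "\<And>s. 0 < s \<Longrightarrow> s < 1 \<Longrightarrow> \<exists>c>0. \<forall>n. c * s ^ n \<le> \<gamma> n"
    and hol: "\<phi> holomorphic_on ball 0 1" and sub: "\<phi> ` ball 0 1 \<subseteq> ball 0 1"
  shows "comp_op_bounded \<gamma> \<phi>"
proof -
  \<comment> \<open>The maximum of |\<open>\<phi>\<close>| on the compact circle is below 1. Taking
    s as the square root of a number in between gives the form s^2 that the tail estimate
    needs.\<close>
  obtain s where s: "0 < s" "s < 1" "\<And>z. cmod z = 1/2 \<Longrightarrow> cmod (\<phi> z) \<le> s\<^sup>2"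
  proof -
    have "continuous_on (sphere 0 (1/2)) \<phi>"
      using hol by (intro holomorphic_on_imp_continuous_on) (auto elim!: holomorphic_on_subset)
    then have "continuous_on (sphere 0 (1/2)) (\<lambda>z. cmod (\<phi> z))"
      by (intro continuous_intros)
    moreover have "sphere (0::complex) (1/2) \<noteq> {}"
      by simp
    ultimately obtain x where x: "x \<in> sphere 0 (1/2)"
      "\<And>z. z \<in> sphere 0 (1/2) \<Longrightarrow> cmod (\<phi> z) \<le> cmod (\<phi> x)"
      using continuous_attains_sup[OF compact_sphere] by metis
    have "x \<in> ball 0 1"
      using x by auto
    with sub have "cmod (\<phi> x) < 1"
      by (auto simp: image_subset_iff)
    then obtain \<rho> where "cmod (\<phi> x) < \<rho>" "\<rho> < 1"
      using dense by blast
    moreover from this have "\<rho> > 0"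
      using norm_ge_zero[of "\<phi> x"] by linarith
    ultimately show thesis
      using x by (intro that[of "sqrt \<rho>"]) (auto intro: order_trans less_imp_le)
  qed
  \<comment> \<open>Cauchy's inequality at radius 1/2 will cost at most 2^N, so a tail of size
    4^(-N) still leaves 2^(-N). \<open>K\<close> is a power of two so that the doubling condition
    can be iterated.\<close>
  obtain q where q: "s ^ q < 1/4"
    using real_arch_pow_inv[of "1/4" s] s by auto
  define K :: nat where "K = 2 ^ q"
  have "s ^ K \<le> s ^ q"
    unfolding K_def using s less_exp[of q] by (intro power_decreasing) auto
  with q have K: "s ^ K \<le> 1/4"
    by linarith
  obtain A where A: "A > 0" "\<And>a n N. (\<Sum>j<N. (cmod (taylor_coeff (\<lambda>z. \<Sum>k<n. a k * \<phi> z ^ k) j))\<^sup>2)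
      \<le> A * (\<Sum>k<n. (cmod (a k))\<^sup>2)"
    by (rule littlewood_taylor_coeff[OF hol sub]) (rule that)
  obtain D where D: "D > 0" "\<And>a k. in_H2 \<gamma> a \<Longrightarrow> cmod (a k) * s ^ k \<le> D * H2_norm \<gamma> a"
    by (rule H2_coeff_growth[OF pos low s(1,2)]) (assumption | rule that)+
  obtain c where c: "c > 0" "\<And>j. c * \<gamma> j \<le> \<gamma> (K * Suc j)"
    unfolding K_def by (rule Delta2_block[of \<gamma> \<delta>, OF pos anti \<delta>, of q]) (assumption | rule that[unfolded K_def])+
  \<comment> \<open>The first summand comes from the low part of the series, the second from the
    tail; both 2s come from (x + y)^2 <= 2x^2 + 2y^2. The operator bound will be
    \<open>sqrt M\<close>.\<close>
  define M where "M = 2 * A / c + 2 * \<gamma> 0 * (D / (1 - s))\<^sup>2"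
  show ?thesis
    unfolding comp_op_bounded_def
  proof (intro exI allI impI)
    fix a
    assume a: "in_H2 \<gamma> a"
    define h where "h = H2_norm \<gamma> a"
    define f where "f z = H2_fun a (\<phi> z)" for z
    define E where "E = (D * h / (1 - s))\<^sup>2"
    have sm: "summable (\<lambda>n. a n * z ^ n)" if "z \<in> ball 0 1" for z
      using H2_summable_power_series[OF pos low a that] by blast
    have "(H2_fun a \<circ> \<phi>) holomorphic_on ball 0 1"
      using H2_fun_holomorphic[OF sm] sub hol by (intro holomorphic_on_compose_gen)
    then have holf: "f holomorphic_on ball 0 1"
      by (simp add: f_def[abs_def] o_def)
    \<comment> \<open>The value 0 at \<open>N = 0\<close> lets the right side be the N-th partial
      sum of a sequence, as Abel summation requires.\<close>
    have partial: "(\<Sum>j<N. (cmod (taylor_coeff f j))\<^sup>2)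
        \<le> 2 * A * (\<Sum>k<N * K. (cmod (a k))\<^sup>2) + (if N = 0 then 0 else 2 * E)" for N
    proof -
      define p where "p z = (\<Sum>k<N * K. a k * \<phi> z ^ k)" for z
      define g where "g z = f z - p z" for z
      have holp: "p holomorphic_on ball 0 1"
        unfolding p_def using hol by (intro holomorphic_intros)
      then have holg: "g holomorphic_on ball 0 1"
        unfolding g_def using holf by (intro holomorphic_intros)
      have sK: "s ^ (N * K) \<le> (1/4) ^ N"
        using power_mono[OF K, of N] s by (simp add: power_mult[symmetric] mult.commute)
      have g_le: "cmod (g z) \<le> D * h / (1 - s) * (1/4) ^ N" if "cmod z = 1/2" for z
      proof -
        have "\<phi> z \<in> ball 0 1"
          using sub that by (auto simp: image_subset_iff)
        then have "cmod (g z) \<le> D * h * s ^ (N * K) / (1 - s)"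
          unfolding g_def f_def p_def h_def
          using D(2)[OF a] s that by (intro H2_tail_le sm) auto
        also have "\<dots> = D * h / (1 - s) * s ^ (N * K)"
          by simp
        also have "\<dots> \<le> D * h / (1 - s) * (1/4) ^ N"
          using sK D s H2_norm_nonneg[OF pos a] by (intro mult_left_mono) (auto simp: h_def)
        finally show ?thesis .
      qed
      \<comment> \<open>The decay 4^(-N) remains after squaring and outweighs the number N of
        coefficients summed below.\<close>
      have coeff_g: "(cmod (taylor_coeff g j))\<^sup>2 \<le> E * (1/4) ^ N" if "j < N" for j
      proof -
        have nn: "D * h / (1 - s) \<ge> 0"
          using D s H2_norm_nonneg[OF pos a] by (simp add: h_def)
        have "cmod (taylor_coeff g j) \<le> D * h / (1 - s) * (1/4) ^ N / (1/2) ^ j"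
          using g_le by (intro taylor_coeff_le holg) auto
        also have "\<dots> = D * h / (1 - s) * (1/4) ^ N * 2 ^ j"
          by (simp add: power_divide)
        also have "\<dots> \<le> D * h / (1 - s) * (1/4) ^ N * 2 ^ N"
          using nn that by (intro mult_left_mono mult_nonneg_nonneg) auto
        also have "\<dots> = D * h / (1 - s) * (1/2) ^ N"
          by (simp add: power_mult_distrib[symmetric] mult.assoc)
        finally have "(cmod (taylor_coeff g j))\<^sup>2 \<le> (D * h / (1 - s) * (1/2) ^ N)\<^sup>2"
          by (rule power_mono) simp
        also have "\<dots> = E * ((1/2)\<^sup>2) ^ N"
          by (simp only: E_def power_mult_distrib power_mult[symmetric] mult.commute[of N])
        finally show ?thesis
          by (simp add: power2_eq_square)
      qed
      have "(\<Sum>j<N. (cmod (taylor_coeff g j))\<^sup>2) \<le> (\<Sum>j<N. E * (1/4) ^ N)"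
        using coeff_g by (intro sum_mono) auto
      also have "\<dots> = E * (real N * (1/4) ^ N)"
        by simp
      also have "\<dots> \<le> (if N = 0 then 0 else E)"
      proof -
        have "real N \<le> 4 ^ N"
          using of_nat_less_two_power[of N, where 'a = real] power_mono[of 2 "4::real" N] by linarith
        then have "real N * (1/4) ^ N \<le> 1"
          by (simp add: power_divide)
        moreover have "E \<ge> 0"
          by (simp add: E_def)
        ultimately show ?thesis
          using mult_left_mono[of "real N * (1/4) ^ N" 1 E] by simp
      qed
      finally have sum_g: "(\<Sum>j<N. (cmod (taylor_coeff g j))\<^sup>2) \<le> (if N = 0 then 0 else E)" .
      have "(\<lambda>z. p z + g z) = f"
        by (simp add: g_def)
      then have tf: "taylor_coeff f j = taylor_coeff p j + taylor_coeff g j" for j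
        using taylor_coeff_add[OF holp holg] by simp
      have "(cmod (taylor_coeff f j))\<^sup>2
          \<le> 2 * (cmod (taylor_coeff p j))\<^sup>2 + 2 * (cmod (taylor_coeff g j))\<^sup>2" for j
      proof -
        let ?x = "cmod (taylor_coeff p j)" and ?y = "cmod (taylor_coeff g j)"
        have "(cmod (taylor_coeff f j))\<^sup>2 \<le> (?x + ?y)\<^sup>2"
          unfolding tf by (intro power_mono norm_triangle_ineq) simp
        also have "\<dots> \<le> 2 * ?x\<^sup>2 + 2 * ?y\<^sup>2"
          using sum_squares_bound[of ?x ?y] by (simp add: power2_sum)
        finally show ?thesis .
      qed
      then have "(\<Sum>j<N. (cmod (taylor_coeff f j))\<^sup>2)
          \<le> (\<Sum>j<N. 2 * (cmod (taylor_coeff p j))\<^sup>2 + 2 * (cmod (taylor_coeff g j))\<^sup>2)"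
        by (intro sum_mono) auto
      also have "\<dots> = 2 * (\<Sum>j<N. (cmod (taylor_coeff p j))\<^sup>2) + 2 * (\<Sum>j<N. (cmod (taylor_coeff g j))\<^sup>2)"
        by (simp add: sum.distrib sum_distrib_left)
      also have "\<dots> \<le> 2 * (A * (\<Sum>k<N * K. (cmod (a k))\<^sup>2)) + 2 * (if N = 0 then 0 else E)"
        using A(2)[of a "N * K" N] sum_g by (intro add_mono mult_left_mono) (auto simp: p_def[abs_def])
      finally show ?thesis
        by (simp add: mult.assoc split: if_splits)
    qed
    have total: "(\<Sum>j<N. (cmod (taylor_coeff f j))\<^sup>2 * \<gamma> j) \<le> M * h\<^sup>2" for N
    proof -
      \<comment> \<open>The increments of the bound in \<open>partial\<close>: one block of length
        \<open>K\<close> for each j, and the whole tail term charged to j = 0, where its weight is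
        \<open>\<gamma> 0\<close>.\<close>
      define y where "y j = 2 * A * (\<Sum>k\<in>{j * K..<j * K + K}. (cmod (a k))\<^sup>2)
        + (if j = 0 then 2 * E else 0)" for j
      have sum_y: "(\<Sum>j<n. y j) = 2 * A * (\<Sum>k<n * K. (cmod (a k))\<^sup>2) + (if n = 0 then 0 else 2 * E)" for n
        by (simp add: y_def sum.distrib sum_distrib_left[symmetric] sum.nat_group)
      have "0 \<le> (\<Sum>j<N. \<gamma> j * (y j - (cmod (taylor_coeff f j))\<^sup>2))"
        using partial pos
        by (intro abel_summation_nonneg anti) (auto simp: sum_subtractf sum_y less_imp_le)
      then have "(\<Sum>j<N. (cmod (taylor_coeff f j))\<^sup>2 * \<gamma> j) \<le> (\<Sum>j<N. \<gamma> j * y j)"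
        by (simp add: right_diff_distrib sum_subtractf mult.commute)
      also have "\<dots> \<le> (\<Sum>j<N. 2 * A / c * (\<Sum>k\<in>{j * K..<j * K + K}. (cmod (a k))\<^sup>2 * \<gamma> k)
          + (if j = 0 then 2 * E * \<gamma> 0 else 0))"
      proof (rule sum_mono)
        fix j
        \<comment> \<open>Each k in the j-th block is below \<open>K * Suc j\<close>, so
          monotonicity and the block estimate let \<open>\<gamma> k / c\<close> replace
          \<open>\<gamma> j\<close>.\<close>
        have "\<gamma> j * (cmod (a k))\<^sup>2 \<le> (cmod (a k))\<^sup>2 * \<gamma> k / c" if "k \<in> {j * K..<j * K + K}" for k
        proof -
          have "c * \<gamma> j \<le> \<gamma> (K * Suc j)"
            by (rule c)
          also have "\<dots> \<le> \<gamma> k"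
            using that by (intro anti) (auto simp: mult.commute)
          finally have "(cmod (a k))\<^sup>2 * (c * \<gamma> j) \<le> (cmod (a k))\<^sup>2 * \<gamma> k"
            by (intro mult_left_mono) auto
          then show ?thesis
            using c(1) by (simp add: field_simps)
        qed
        then have "(\<Sum>k\<in>{j * K..<j * K + K}. \<gamma> j * (cmod (a k))\<^sup>2)
            \<le> (\<Sum>k\<in>{j * K..<j * K + K}. (cmod (a k))\<^sup>2 * \<gamma> k / c)"
          by (rule sum_mono)
        then have "2 * A * (\<Sum>k\<in>{j * K..<j * K + K}. \<gamma> j * (cmod (a k))\<^sup>2)
            \<le> 2 * A * (\<Sum>k\<in>{j * K..<j * K + K}. (cmod (a k))\<^sup>2 * \<gamma> k / c)"
          using A(1) by (intro mult_left_mono) auto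
        moreover have "\<gamma> j * y j = 2 * A * (\<Sum>k\<in>{j * K..<j * K + K}. \<gamma> j * (cmod (a k))\<^sup>2)
            + (if j = 0 then 2 * E * \<gamma> 0 else 0)"
          by (simp add: y_def distrib_left sum_distrib_left mult_ac)
        ultimately show "\<gamma> j * y j \<le> 2 * A / c * (\<Sum>k\<in>{j * K..<j * K + K}. (cmod (a k))\<^sup>2 * \<gamma> k)
            + (if j = 0 then 2 * E * \<gamma> 0 else 0)"
          by (simp add: sum_divide_distrib[symmetric])
      qed
      also have "\<dots> = 2 * A / c * (\<Sum>k<N * K. (cmod (a k))\<^sup>2 * \<gamma> k) + (if N = 0 then 0 else 2 * E * \<gamma> 0)"
        by (simp only: sum.distrib sum_distrib_left[symmetric] sum.nat_group) simp
      also have "\<dots> \<le> 2 * A / c * h\<^sup>2 + 2 * E * \<gamma> 0"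
        using A(1) c(1) pos H2_partial_sum_le[OF pos a, of "{..<N * K}"]
        by (intro add_mono mult_left_mono) (auto simp: h_def E_def less_imp_le)
      also have "\<dots> = M * h\<^sup>2"
        by (simp add: M_def E_def algebra_simps power_mult_distrib power_divide)
      finally show ?thesis .
    qed
    have nn: "0 \<le> (cmod (taylor_coeff f j))\<^sup>2 * \<gamma> j" for j
      using pos by (simp add: less_imp_le)
    have in_H2: "in_H2 \<gamma> (taylor_coeff f)"
      unfolding in_H2_def by (rule summableI_nonneg_bounded[OF nn total])
    have "(\<Sum>j. (cmod (taylor_coeff f j))\<^sup>2 * \<gamma> j) \<le> M * h\<^sup>2"
      using in_H2 total by (intro suminf_le_const) (auto simp: in_H2_def)
    then have "H2_norm \<gamma> (taylor_coeff f) \<le> sqrt (M * h\<^sup>2)"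
      unfolding H2_norm_def by (rule real_sqrt_le_mono)
    also have "\<dots> = sqrt M * h"
      using H2_norm_nonneg[OF pos a] by (simp add: real_sqrt_mult h_def)
    finally show "in_H2 \<gamma> (taylor_coeff f) \<and>
        (\<forall>z\<in>ball 0 1. H2_fun a (\<phi> z) = H2_fun (taylor_coeff f) z) \<and>
        H2_norm \<gamma> (taylor_coeff f) \<le> sqrt M * H2_norm \<gamma> a"
      using in_H2 H2_fun_taylor_coeff[OF holf] by (simp add: f_def h_def)
  qed
qed

section \<open>Comparison of weights\<close>

lemma in_H2_mono:
  assumes "\<And>n. 0 \<le> \<beta> n" "\<And>n. \<beta> n \<le> C * \<gamma> n" "in_H2 \<gamma> a"
  shows "in_H2 \<beta> a"
proof -
  have "summable (\<lambda>n. C * ((cmod (a n))\<^sup>2 * \<gamma> n))"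
    using assms(3) by (intro summable_mult) (simp add: in_H2_def)
  moreover have "norm ((cmod (a n))\<^sup>2 * \<beta> n) \<le> C * ((cmod (a n))\<^sup>2 * \<gamma> n)" for n
    using assms(1)[of n] mult_left_mono[OF assms(2), of "(cmod (a n))\<^sup>2" n] by (simp add: mult_ac)
  ultimately show ?thesis
    unfolding in_H2_def by (blast intro: summable_comparison_test'[where N = 0])
qed

lemma H2_norm_mono:
  assumes "\<And>n. 0 \<le> \<beta> n" "\<And>n. \<beta> n \<le> C * \<gamma> n" "in_H2 \<gamma> a"
  shows "H2_norm \<beta> a \<le> sqrt C * H2_norm \<gamma> a"
proof -
  have "(\<Sum>n. (cmod (a n))\<^sup>2 * \<beta> n) \<le> (\<Sum>n. C * ((cmod (a n))\<^sup>2 * \<gamma> n))"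
  proof (rule suminf_le)
    show "(cmod (a n))\<^sup>2 * \<beta> n \<le> C * ((cmod (a n))\<^sup>2 * \<gamma> n)" for n
      using mult_left_mono[OF assms(2), of "(cmod (a n))\<^sup>2" n] by (simp add: mult_ac)
    show "summable (\<lambda>n. (cmod (a n))\<^sup>2 * \<beta> n)"
      using in_H2_mono[OF assms] by (simp add: in_H2_def)
    show "summable (\<lambda>n. C * ((cmod (a n))\<^sup>2 * \<gamma> n))"
      using assms(3) by (intro summable_mult) (simp add: in_H2_def)
  qed
  also have "\<dots> = C * (\<Sum>n. (cmod (a n))\<^sup>2 * \<gamma> n)"
    using assms(3) by (intro suminf_mult) (simp add: in_H2_def)
  finally show ?thesis
    unfolding H2_norm_def real_sqrt_mult[symmetric] by (rule real_sqrt_le_mono)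
qed

text \<open>Both weights admit the same sequences with equivalent norms, so the same image sequence
  \<open>b\<close> serves for both.\<close>

lemma comp_op_bounded_equivalent_weight:
  assumes pos: "\<And>n. 0 < \<gamma> n" and le: "\<And>n. \<gamma> n \<le> \<beta> n" "\<And>n. \<beta> n \<le> C * \<gamma> n"
    and bd: "comp_op_bounded \<gamma> \<phi>"
  shows "comp_op_bounded \<beta> \<phi>"
proof -
  have pos\<beta>: "0 < \<beta> n" for n
    using pos le(1) less_le_trans by blast
  have "0 < C * \<gamma> 0"
    using pos\<beta>[of 0] le(2)[of 0] by linarith
  then have C: "C > 0"
    using pos[of 0] by (simp add: zero_less_mult_iff)
  obtain M where M: "\<And>a. in_H2 \<gamma> a \<Longrightarrow> \<exists>b. in_H2 \<gamma> b \<and>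
      (\<forall>z\<in>ball 0 1. H2_fun a (\<phi> z) = H2_fun b z) \<and> H2_norm \<gamma> b \<le> M * H2_norm \<gamma> a"
    using bd unfolding comp_op_bounded_def by blast
  show ?thesis
    unfolding comp_op_bounded_def
  \<comment> \<open>The bound \<open>M\<close> may be negative as far as the definition tells; the
    absolute value keeps the passage to the larger norm of \<open>a\<close> monotone.\<close>
  proof (intro exI[of _ "sqrt C * \<bar>M\<bar>"] allI impI)
    fix a
    assume a: "in_H2 \<beta> a"
    have a': "in_H2 \<gamma> a" and norm_a: "H2_norm \<gamma> a \<le> H2_norm \<beta> a"
      using in_H2_mono[of \<gamma> 1 \<beta> a] H2_norm_mono[of \<gamma> 1 \<beta> a] a pos le(1)
      by (auto simp: less_imp_le)
    obtain b where b: "in_H2 \<gamma> b" "\<And>z. z \<in> ball 0 1 \<Longrightarrow> H2_fun a (\<phi> z) = H2_fun b z"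
      "H2_norm \<gamma> b \<le> M * H2_norm \<gamma> a"
      using M[OF a'] by blast
    have b': "in_H2 \<beta> b" and "H2_norm \<beta> b \<le> sqrt C * H2_norm \<gamma> b"
      using in_H2_mono[OF _ le(2) b(1)] H2_norm_mono[OF _ le(2) b(1)] pos\<beta> by (auto simp: less_imp_le)
    note this(2)
    also have "sqrt C * H2_norm \<gamma> b \<le> sqrt C * (\<bar>M\<bar> * H2_norm \<beta> a)"
    proof -
      have "M * H2_norm \<gamma> a \<le> \<bar>M\<bar> * H2_norm \<beta> a"
        using norm_a H2_norm_nonneg[OF pos a'] by (intro mult_mono) auto
      then show ?thesis
        using b(3) C by (intro mult_left_mono) auto
    qed
    finally show "\<exists>b. in_H2 \<beta> b \<and> (\<forall>z\<in>ball 0 1. H2_fun a (\<phi> z) = H2_fun b z)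
        \<and> H2_norm \<beta> b \<le> sqrt C * \<bar>M\<bar> * H2_norm \<beta> a"
      using b' b(2) by (auto simp: mult.assoc)
  qed
qed

lemma liminf_root_lower_bound:
  fixes \<beta> :: "nat \<Rightarrow> real"
  assumes pos: "\<And>n. \<beta> n > 0" and lim: "liminf (\<lambda>n. ereal (root n (\<beta> n))) \<ge> 1"
    and s: "0 < s" "s < 1"
  shows "\<exists>c>0. \<forall>n. c * s ^ n \<le> \<beta> n"
proof -
  have "ereal s < liminf (\<lambda>n. ereal (root n (\<beta> n)))"
    using s lim by (intro less_le_trans[OF _ lim]) auto
  from less_LiminfD[OF this] obtain N where N: "\<And>n. n \<ge> N \<Longrightarrow> s < root n (\<beta> n)"
    by (auto simp: eventually_sequentially)
  \<comment> \<open>Starting at \<open>Suc N\<close> excludes n = 0, where \<open>root 0\<close> is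
    constantly 0 and the root cannot be undone.\<close>
  have big: "s ^ n \<le> \<beta> n" if "n \<ge> Suc N" for n
  proof -
    have "s ^ n \<le> root n (\<beta> n) ^ n"
      using N[of n] that s by (intro power_mono) auto
    also have "\<dots> = \<beta> n"
      using that pos[of n] by simp
    finally show ?thesis .
  qed
  \<comment> \<open>The minimum handles the finitely many small n; inserting 1 gives
    \<open>c \<le> 1\<close>, which suffices for the large ones.\<close>
  define c where "c = Min (insert 1 (\<beta> ` {..N}))"
  have "c > 0" "c \<le> 1"
    using pos by (auto simp: c_def)
  moreover have "c * s ^ n \<le> \<beta> n" for n
  proof (cases "n \<ge> Suc N")
    case True
    have "c * s ^ n \<le> s ^ n"
      using \<open>c \<le> 1\<close> s by (intro mult_left_le_one_le) (use \<open>c > 0\<close> in auto)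
    then show ?thesis
      using big[OF True] by linarith
  next
    case False
    then have "c \<le> \<beta> n"
      unfolding c_def by (intro Min_le) auto
    moreover have "c * s ^ n \<le> c"
      using \<open>c > 0\<close> s by (intro mult_left_le) (auto intro: power_le_one)
    ultimately show ?thesis
      by linarith
  qed
  ultimately show ?thesis
    by blast
qed

theorem mainTheorem7:
  fixes \<beta> :: "nat \<Rightarrow> real" and \<phi> :: "complex \<Rightarrow> complex"
  assumes "\<And>n. \<beta> n > 0"
    and "essentially_decreasing \<beta>"
    and "liminf (\<lambda>n. ereal (root n (\<beta> n))) \<ge> 1"
    and "Delta2_condition \<beta>"
    and "symbol \<phi>"
  shows "comp_op_bounded \<beta> \<phi>"
proof -
  \<comment> \<open>The largest decreasing minorant of \<open>\<beta>\<close>. The minimum is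
    attained at some earlier index, so essential decrease bounds \<open>\<beta>\<close> by
    \<open>C\<close> times it.\<close>
  define \<gamma> where "\<gamma> n = Min (\<beta> ` {..n})" for n
  obtain C where C: "C \<ge> 1" "\<And>m n. n \<le> m \<Longrightarrow> \<beta> m \<le> C * \<beta> n"
    using assms(2) by (auto simp: essentially_decreasing_def)
  obtain \<delta> where \<delta>: "0 < \<delta>" "\<delta> < 1" "\<And>n. \<delta> * \<beta> n \<le> \<beta> (2 * n)"
    using assms(4) by (auto simp: Delta2_condition_def)
  have pos: "\<gamma> n > 0" and le: "\<gamma> n \<le> \<beta> n" for n
    using assms(1) by (auto simp: \<gamma>_def)
  have ge: "\<beta> n \<le> C * \<gamma> n" for n
  proof -
    have "\<gamma> n \<in> \<beta> ` {..n}"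
      unfolding \<gamma>_def by (intro Min_in) auto
    then show ?thesis
      using C(2) by auto
  qed
  have anti: "\<gamma> n \<le> \<gamma> m" if "m \<le> n" for m n
    unfolding \<gamma>_def using that by (intro Min_antimono) auto
  have "comp_op_bounded \<gamma> \<phi>"
  proof (rule comp_op_bounded_antitone[OF pos anti])
    show "0 < \<delta> / C"
      using \<delta> C by simp
    \<comment> \<open>The loss of the factor \<open>C\<close> comes from returning from
      \<open>\<beta> (2 * n)\<close> to \<open>\<gamma> (2 * n)\<close>.\<close>
    show "\<delta> / C * \<gamma> n \<le> \<gamma> (2 * n)" for n
    proof -
      have "\<delta> * \<gamma> n \<le> \<delta> * \<beta> n"
        using le \<delta> by (intro mult_left_mono) auto
      also have "\<dots> \<le> C * \<gamma> (2 * n)"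
        using \<delta>(3)[of n] ge[of "2 * n"] by linarith
      finally show ?thesis
        using C(1) by (simp add: field_simps)
    qed
    show "\<exists>c>0. \<forall>n. c * s ^ n \<le> \<gamma> n" if s: "0 < s" "s < 1" for s
    proof -
      obtain c where c: "c > 0" "\<And>n. c * s ^ n \<le> \<beta> n"
        using liminf_root_lower_bound[OF assms(1,3) s] by blast
      have "c / C * s ^ n \<le> \<gamma> n" for n
        using order_trans[OF c(2) ge, of n] C(1) by (simp add: field_simps)
      then show ?thesis
        using c(1) C(1) by (intro exI[of _ "c / C"]) auto
    qed
  qed (use assms(5) in \<open>auto simp: symbol_def\<close>)
  with pos le ge show ?thesis
    by (rule comp_op_bounded_equivalent_weight)
qed

end
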